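(* A subgroup $\widehat S$ of $\widehat M$ is a Neumann subgroup of $\widehat M$ if and only if it is generated by an involution, that is, if and only if there exist an involution $\iota:\mathbb Z\to\mathbb Z$ (a map with $\iota\circ\iota=\mathrm{id}$) and a sequence $(\delta_n)_{n\in\mathbb Z}\in\{-1,1\}^{\mathbb Z}$ satisfying $$\iota(\iota(n)-\delta_n)=\iota(n+1)+\delta_{n+1},\qquad \delta_n=\delta_{\iota(n)}\qquad\text{for all } n\in\mathbb Z,$$ such that $\widehat S$ is the subgroup of $\widehat M$ generated by the elements $\sigma_n$, $n\in\mathbb Z$, where $$\sigma_n(z)=\frac{nz-n\iota(n)-\delta_n}{z-\iota(n)}.$$
   Context: Let $\widehat M$ be the extended modular group, i.e. the group of all maps $z\mapsto \frac{az+b}{cz+d}$ with $a,b,c,d\in\mathbb Z$, $ad-bc=\pm1$, acting on $\overline{\mathbb Q}=\mathbb Q\cup\{\infty\}$ (with the usual conventions for $\infty$); it is identified with $PGL(2,\mathbb Z)=GL(2,\mathbb Z)/\{\pm I\}$. Note that the matrix $\begin{pmatrix} n & -n\iota(n)-\delta_n\\ 1&-\iota(n)\end{pmatrix}$ representing $\sigma_n$ has determinant $\delta_n$. A subgroup $\widehat S\subset\widehat M$ is a Neumann subgroup of $\widehat M$ if for every $r\in\overline{\mathbb Q}$ there exists exactly one $\alpha\in\widehat S$ with $\alpha(\infty)=r$. *)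

theory Defs
  imports "HOL-Algebra.Algebra"
begin

datatype ext_rat = Fin rat | Infty

text \<open>The usual conventions: \<open>\<infinity>\<close> is mapped to \<open>a/c\<close>, which means \<open>\<infinity>\<close> if \<open>c = 0\<close>, and a
  zero of the denominator is mapped to \<open>\<infinity>\<close>. This is meaningful only if the determinant
  \<open>ad - bc\<close> is nonzero.\<close>

fun moebius :: "int \<Rightarrow> int \<Rightarrow> int \<Rightarrow> int \<Rightarrow> ext_rat \<Rightarrow> ext_rat" where
  "moebius a b c d Infty =
     (if c = 0 then Infty else Fin (of_int a / of_int c))"
| "moebius a b c d (Fin z) =
     (if of_int c * z + of_int d = 0 then Infty
      else Fin ((of_int a * z + of_int b) / (of_int c * z + of_int d)))"

definition ext_modular_group :: "(ext_rat \<Rightarrow> ext_rat) monoid" where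
  "ext_modular_group =
     \<lparr>carrier = {moebius a b c d | a b c d. a * d - b * c \<in> {1, -1}},
      monoid.mult = (\<circ>), one = id\<rparr>"

definition Neumann_subgroup :: "(ext_rat \<Rightarrow> ext_rat) set \<Rightarrow> bool" where
  "Neumann_subgroup S \<longleftrightarrow>
     subgroup S ext_modular_group \<and> (\<forall>r. \<exists>!\<alpha>. \<alpha> \<in> S \<and> \<alpha> Infty = r)"

definition neumann_sigma :: "(int \<Rightarrow> int) \<Rightarrow> (int \<Rightarrow> int) \<Rightarrow> int \<Rightarrow> ext_rat \<Rightarrow> ext_rat" where
  "neumann_sigma \<iota> \<delta> n = moebius n (- n * \<iota> n - \<delta> n) 1 (- \<iota> n)"

lemma moebius_in_carrier:
  assumes "a * d - b * c \<in> {1, -1}"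
  shows "moebius a b c d \<in> carrier ext_modular_group"
proof -
  have "\<exists>a' b' c' d'. moebius a b c d = moebius a' b' c' d' \<and> a' * d' - b' * c' \<in> {1, -1}"
    by (rule exI[of _ a], rule exI[of _ b], rule exI[of _ c], rule exI[of _ d]) (use assms in simp)
  then show ?thesis by (simp add: ext_modular_group_def)
qed

lemma moebius_id: "moebius 1 0 0 1 = id"
proof
  fix z show "moebius 1 0 0 1 z = id z" by (cases z) auto
qed

lemma moebius_comp:
  assumes "a * d - b * c \<noteq> 0" and "a' * d' - b' * c' \<noteq> 0"
  shows "moebius a b c d \<circ> moebius a' b' c' d' =
    moebius (a * a' + b * c') (a * b' + b * d') (c * a' + d * c') (c * b' + d * d')"
proof
  define A B C D A' B' C' D' :: rat where defs: "A = of_int a" "B = of_int b" "C = of_int c"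
    "D = of_int d" "A' = of_int a'" "B' = of_int b'" "C' = of_int c'" "D' = of_int d'"
  have "of_int (a * d - b * c) \<noteq> (0::rat)" using assms(1) by (simp only: of_int_eq_0_iff) simp
  then have n1: "A * D - B * C \<noteq> 0" by (simp add: defs)
  have "of_int (a' * d' - b' * c') \<noteq> (0::rat)" using assms(2) by (simp only: of_int_eq_0_iff) simp
  then have n2: "A' * D' - B' * C' \<noteq> 0" by (simp add: defs)
  have key: "(if v = 0 then (if C = 0 then Infty else Fin (A / C))
         else if C * (u / v) + D = 0 then Infty
         else Fin ((A * (u / v) + B) / (C * (u / v) + D))) =
        (if C * u + D * v = 0 then Infty else Fin ((A * u + B * v) / (C * u + D * v)))"
    if "u \<noteq> 0 \<or> v \<noteq> 0" for u v :: rat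
  proof (cases "v = 0")
    case False
    have "C * (u / v) + D = (C * u + D * v) / v" "A * (u / v) + B = (A * u + B * v) / v"
      using False by (simp_all add: field_simps)
    then show ?thesis using False by simp
  qed (use that in auto)
  fix z
  show "(moebius a b c d \<circ> moebius a' b' c' d') z =
    moebius (a * a' + b * c') (a * b' + b * d') (c * a' + d * c') (c * b' + d * d') z"
  proof (cases z)
    case Infty
    have c0: "c = 0 \<longleftrightarrow> C = 0" "c' = 0 \<longleftrightarrow> C' = 0"
      "c * a' + d * c' = 0 \<longleftrightarrow> C * A' + D * C' = 0"
      unfolding defs by (simp_all flip: of_int_mult of_int_add)
    have "A' \<noteq> 0 \<or> C' \<noteq> 0" using n2 by auto
    note k = key[OF this]
    have "(moebius a b c d \<circ> moebius a' b' c' d') z =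
        (if C' = 0 then (if C = 0 then Infty else Fin (A / C))
         else if C * (A' / C') + D = 0 then Infty
         else Fin ((A * (A' / C') + B) / (C * (A' / C') + D)))"
      using Infty c0(1,2) by (simp add: defs)
    also note k
    also have "(if C * A' + D * C' = 0 then Infty
         else Fin ((A * A' + B * C') / (C * A' + D * C'))) =
        moebius (a * a' + b * c') (a * b' + b * d') (c * a' + d * c') (c * b' + d * d') z"
      using Infty c0(3) by (simp add: defs)
    finally show ?thesis .
  next
    case (Fin x)
    have c0: "c = 0 \<longleftrightarrow> C = 0" unfolding defs by simp
    have "A' * x + B' \<noteq> 0 \<or> C' * x + D' \<noteq> 0"
    proof (rule ccontr)
      assume "\<not> ?thesis"
      then have e: "A' * x + B' = 0" "C' * x + D' = 0" by auto
      have "A' * D' - B' * C' = A' * (C' * x + D') - C' * (A' * x + B')" by (simp add: algebra_simps)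
      then show False using e n2 by simp
    qed
    note k = key[OF this]
    have e: "C * (A' * x + B') + D * (C' * x + D') = (C * A' + D * C') * x + (C * B' + D * D')"
      "A * (A' * x + B') + B * (C' * x + D') = (A * A' + B * C') * x + (A * B' + B * D')"
      by (simp_all add: algebra_simps)
    have "(moebius a b c d \<circ> moebius a' b' c' d') z =
        (if C' * x + D' = 0 then (if C = 0 then Infty else Fin (A / C))
         else if C * ((A' * x + B') / (C' * x + D')) + D = 0 then Infty
         else Fin ((A * ((A' * x + B') / (C' * x + D')) + B)
           / (C * ((A' * x + B') / (C' * x + D')) + D)))"
      using Fin c0 by (simp add: defs)
    also note k
    also have "(if C * (A' * x + B') + D * (C' * x + D') = 0 then Infty
         else Fin ((A * (A' * x + B') + B * (C' * x + D')) /
           (C * (A' * x + B') + D * (C' * x + D')))) =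
        moebius (a * a' + b * c') (a * b' + b * d') (c * a' + d * c') (c * b' + d * d') z"
      unfolding e using Fin by (simp add: defs)
    finally show ?thesis .
  qed
qed

lemma group_ext_modular_group: "group ext_modular_group"
proof (rule groupI)
  fix x y assume "x \<in> carrier ext_modular_group" "y \<in> carrier ext_modular_group"
  then obtain a b c d a' b' c' d' where
    x: "x = moebius a b c d" "a * d - b * c \<in> {1, -1}" and
    y: "y = moebius a' b' c' d'" "a' * d' - b' * c' \<in> {1, -1}"
    by (auto simp: ext_modular_group_def)
  have "(a * a' + b * c') * (c * b' + d * d') - (a * b' + b * d') * (c * a' + d * c') =
      (a * d - b * c) * (a' * d' - b' * c')" by (simp add: algebra_simps)
  also have "\<dots> \<in> {1, -1}" using x(2) y(2) by auto
  finally have dt: "(a * a' + b * c') * (c * b' + d * d') - (a * b' + b * d') * (c * a' + d * c') \<in> {1, -1}" .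
  have "a * d - b * c \<noteq> 0" "a' * d' - b' * c' \<noteq> 0" using x(2) y(2) by auto
  from moebius_comp[OF this]
  have "x \<otimes>\<^bsub>ext_modular_group\<^esub> y =
      moebius (a * a' + b * c') (a * b' + b * d') (c * a' + d * c') (c * b' + d * d')"
    by (simp add: ext_modular_group_def x(1) y(1))
  with moebius_in_carrier[OF dt]
  show "x \<otimes>\<^bsub>ext_modular_group\<^esub> y \<in> carrier ext_modular_group" by simp
next
  have "(1::int) * 1 - 0 * 0 \<in> {1, -1}" by simp
  then show "\<one>\<^bsub>ext_modular_group\<^esub> \<in> carrier ext_modular_group"
    using moebius_in_carrier[of 1 1 0 0] by (simp add: ext_modular_group_def moebius_id)
next
  fix x assume "x \<in> carrier ext_modular_group"
  then obtain a b c d where x: "x = moebius a b c d" "a * d - b * c = 1 \<or> a * d - b * c = -1"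
    by (auto simp: ext_modular_group_def)
  define e where "e = a * d - b * c"
  have e: "e * e = 1" using x(2) by (auto simp: e_def)
  define y where "y = moebius (e * d) (- e * b) (- e * c) (e * a)"
  have dt: "(e * d) * (e * a) - (- e * b) * (- e * c) = e"
  proof -
    have "(e * d) * (e * a) - (- e * b) * (- e * c) = (e * e) * (a * d - b * c)"
      by (simp add: algebra_simps)
    then show ?thesis using e by (simp add: e_def)
  qed
  have "y \<in> carrier ext_modular_group"
    unfolding y_def by (rule moebius_in_carrier) (use dt x(2) in \<open>simp add: e_def\<close>)
  moreover have "y \<circ> x = id"
  proof -
    have m: "e * d * a + - e * b * c = 1" "e * d * b + - e * b * d = 0"
      "- e * c * a + e * a * c = 0" "- e * c * b + e * a * d = 1"
      using e by (simp_all add: e_def algebra_simps)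
    have "(e * d) * (e * a) - (- e * b) * (- e * c) \<noteq> 0" "a * d - b * c \<noteq> 0"
      using dt x(2) e_def by auto
    from moebius_comp[OF this, unfolded m moebius_id]
    show ?thesis unfolding y_def x(1) .
  qed
  ultimately have "y \<in> carrier ext_modular_group"
    "y \<otimes>\<^bsub>ext_modular_group\<^esub> x = \<one>\<^bsub>ext_modular_group\<^esub>"
    by (simp_all only:) (simp add: ext_modular_group_def)
  then show "\<exists>y\<in>carrier ext_modular_group.
      y \<otimes>\<^bsub>ext_modular_group\<^esub> x = \<one>\<^bsub>ext_modular_group\<^esub>"
    by blast
qed (auto simp: ext_modular_group_def comp_assoc)

lemma neumann_sigma_in_carrier:
  assumes "\<delta> n \<in> {-1, 1}"
  shows "neumann_sigma \<iota> \<delta> n \<in> carrier ext_modular_group"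
proof -
  have "n * (- \<iota> n) - (- n * \<iota> n - \<delta> n) * 1 \<in> {1, -1}" using assms by auto
  then show ?thesis unfolding neumann_sigma_def by (rule moebius_in_carrier)
qed

end

theory Submission
  imports Defs
begin

text \<open>
  The involution \<open>\<iota>\<close> of a Neumann subgroup \<open>S\<close> records where the element \<open>\<sigma>\<^sub>n \<in> S\<close> with
  \<open>\<sigma>\<^sub>n(\<infinity>) = n\<close> has its pole, and \<open>\<delta>\<^sub>n\<close> is its determinant, so that
  \<open>\<sigma>\<^sub>n(z) = n - \<delta>\<^sub>n / (z - \<iota>(n))\<close>. Since \<open>S\<close> contains only one element for each
  image of \<open>\<infinity>\<close>, two identities are forced:
  \<^item> \<open>\<sigma>\<^sub>n\<inverse>\<close> maps \<open>\<infinity>\<close> to \<open>\<iota>(n)\<close>, hence \<open>\<sigma>\<^sub>n\<inverse> = \<sigma>\<^bsub>\<iota>(n)\<^esub>\<close>;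
  \<^item> \<open>\<sigma>\<^sub>n\<close> maps \<open>k = \<iota>(n) - \<delta>\<^sub>n\<close> to \<open>n + 1\<close>, hence \<open>\<sigma>\<^sub>n \<sigma>\<^sub>k = \<sigma>\<^bsub>n+1\<^esub>\<close>.

  Comparing poles and determinants turns them into the conditions on \<open>\<iota>\<close> and \<open>\<delta>\<close>. The second
  identity also says \<open>\<delta>\<^bsub>n+1\<^esub> = \<delta>\<^sub>n \<delta>\<^sub>k\<close>, which is absent from these conditions but
  follows from them (\<open>delta_Suc\<close>); hence the conditions give both identities back.

  The \<open>\<sigma>\<^sub>n\<close> move \<open>\<infinity>\<close> to every point by the Euclidean algorithm: dividing \<open>p\<close> by \<open>q\<close>
  with quotient \<open>n\<close> and remainder \<open>m > 0\<close>, the map \<open>\<sigma>\<^sub>n\<inverse>\<close> sends \<open>p/q\<close> to a fraction with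
  denominator \<open>m < q\<close> (\<open>generated_transitive\<close>). Inside a Neumann subgroup this shows that
  the \<open>\<sigma>\<^sub>n\<close> generate it.

  Conversely, only the identity in the group generated by the \<open>\<sigma>\<^sub>n\<close> may fix \<open>\<infinity>\<close>. The two
  identities shorten a product \<open>\<sigma>\<^sub>m \<sigma>\<^sub>k\<close> whenever \<open>\<bar>k - \<iota>(m)\<bar> \<le> 1\<close>, so every element is a
  product over a reduced word, one in which \<open>\<bar>k - \<iota>(m)\<bar> \<ge> 2\<close> for adjacent letters
  (\<open>generated_reduced\<close>). A ping-pong argument, with the open intervals of radius 1 around the
  integers, shows that a nonempty reduced word starting with \<open>n\<close> maps \<open>\<infinity>\<close> to a finite point at
  distance less than 1 from \<open>n\<close> (\<open>reduced_word_Infty\<close>).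
\<close>

section \<open>Maps with prescribed image of infinity, pole and determinant\<close>

lemma mult_ext [simp]: "x \<otimes>\<^bsub>ext_modular_group\<^esub> y = x \<circ> y"
  by (simp add: ext_modular_group_def)

lemma one_ext [simp]: "\<one>\<^bsub>ext_modular_group\<^esub> = id"
  by (simp add: ext_modular_group_def)

lemma sign_sq: "s * s = 1" if "s \<in> {-1, 1}" for s :: int
  using that by auto

lemma moebius_scale:
  assumes "s \<in> {-1, 1}"
  shows "moebius (s * a) (s * b) (s * c) (s * d) = moebius a b c d"
proof
  fix z
  have e: "- (x * y) - u = - (x * y + u)" for x y u :: rat by simp
  show "moebius (s * a) (s * b) (s * c) (s * d) z = moebius a b c d z"
    using assms by (cases z) (auto simp: e simp del: minus_add_distrib)
qed

text \<open>
  The element \<open>z \<mapsto> n - d / (z - i)\<close>: it sends \<open>\<infinity>\<close> to \<open>n\<close>, has its pole at \<open>i\<close> and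
  determinant \<open>d\<close>. Letting the three parameters vary independently allows an element to be named
  before it is known that its pole is \<open>\<iota>(n)\<close>.
\<close>
definition pole_map :: "int \<Rightarrow> int \<Rightarrow> int \<Rightarrow> ext_rat \<Rightarrow> ext_rat" where
  "pole_map n i d = moebius n (- n * i - d) 1 (- i)"

lemma neumann_sigma_eq: "neumann_sigma \<iota> \<delta> n = pole_map n (\<iota> n) (\<delta> n)"
  by (simp add: neumann_sigma_def pole_map_def)

lemma pole_map_Infty [simp]: "pole_map n i d Infty = Fin (of_int n)"
  by (simp add: pole_map_def)

lemma pole_map_Fin:
  "pole_map n i d (Fin z) =
     (if z = of_int i then Infty else Fin (of_int n - of_int d / (z - of_int i)))"
  by (auto simp: pole_map_def field_simps)

lemma pole_map_eq_iff:
  "pole_map n i d = pole_map n' i' d' \<longleftrightarrow> n = n' \<and> i = i' \<and> d = d'"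
proof
  assume eq: "pole_map n i d = pole_map n' i' d'"
  have n: "n = n'" using fun_cong[OF eq, of Infty] by simp
  have i: "i = i'" using fun_cong[OF eq, of "Fin (of_int i)"]
    by (simp add: pole_map_Fin split: if_splits)
  have "d = d'" using fun_cong[OF eq, of "Fin (of_int i + 1)"] n i
    by (simp add: pole_map_Fin)
  with n i show "n = n' \<and> i = i' \<and> d = d'" by simp
qed simp

lemma pole_map_carrier:
  "d \<in> {-1, 1} \<Longrightarrow> pole_map n i d \<in> carrier ext_modular_group"
  unfolding pole_map_def by (rule moebius_in_carrier) auto

lemma pole_map_comp_inverse:
  assumes "d \<in> {-1, 1}"
  shows "pole_map n i d \<circ> pole_map i n d = id"
proof -
  have "pole_map n i d \<circ> pole_map i n d = moebius (- d * 1) (- d * 0) (- d * 0) (- d * 1)"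
    unfolding pole_map_def
    by (subst moebius_comp) (use assms in \<open>auto simp: algebra_simps\<close>)
  also have "\<dots> = id"
    by (subst moebius_scale) (use assms in \<open>auto simp: moebius_id\<close>)
  finally show ?thesis .
qed

lemma pole_map_inv:
  assumes "d \<in> {-1, 1}"
  shows "inv\<^bsub>ext_modular_group\<^esub> (pole_map n i d) = pole_map i n d"
  by (rule group.inv_equality[OF group_ext_modular_group])
    (use assms in \<open>simp_all add: pole_map_comp_inverse pole_map_carrier\<close>)

text \<open>
  The point \<open>i - d\<close> is the neighbour of the pole that is mapped to \<open>n + 1\<close>; the product is
  therefore again of the form \<open>pole_map\<close>.
\<close>
lemma pole_map_comp_neighbour:
  assumes d: "d \<in> {-1, 1}" and e: "e \<in> {-1, 1}"
  shows "pole_map n i d \<circ> pole_map (i - d) j e = pole_map (n + 1) (j - d * e) (d * e)"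
proof -
  note dd = sign_sq[OF d]
  have dd': "d * (d * x) = x" for x using dd by (simp flip: mult.assoc)
  have "pole_map n i d \<circ> pole_map (i - d) j e =
      moebius (- d * (n + 1)) (- d * (- (n + 1) * (j - d * e) - d * e)) (- d * 1)
        (- d * (- (j - d * e)))"
    unfolding pole_map_def
    by (subst moebius_comp) (use assms in \<open>auto simp: algebra_simps dd dd'\<close>)
  also have "\<dots> = pole_map (n + 1) (j - d * e) (d * e)"
    unfolding pole_map_def by (rule moebius_scale) (use d in auto)
  finally show ?thesis .
qed

text \<open>
  If \<open>a/c\<close> is an integer, then \<open>c\<close> divides the determinant, so \<open>c = \<plusminus>1\<close>, and the sign of the
  matrix can be chosen such that \<open>c = 1\<close>.
\<close>
lemma carrier_integer_value:
  assumes "\<alpha> \<in> carrier ext_modular_group" and "\<alpha> Infty = Fin (of_int n)"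
  shows "\<exists>i d. d \<in> {-1, 1} \<and> \<alpha> = pole_map n i d"
proof -
  obtain a b c d where al: "\<alpha> = moebius a b c d" and det: "a * d - b * c \<in> {1, -1}"
    using assms(1) by (auto simp: ext_modular_group_def)
  have c: "c \<noteq> 0" and "of_int a = (of_int (n * c) :: rat)"
    using assms(2) unfolding al by (auto split: if_splits simp: field_simps)
  then have a: "a = n * c" by (simp only: of_int_eq_iff)
  have "c dvd a * d - b * c" unfolding a by simp
  then have "c dvd 1" using det by auto
  then have cs: "c \<in> {-1, 1}" by (auto simp: zdvd1_eq)
  have cc: "c * c = 1" by (rule sign_sq[OF cs])
  have "\<alpha> = moebius (c * a) (c * b) (c * c) (c * d)"
    unfolding al by (rule moebius_scale[OF cs, symmetric])
  also have "\<dots> = pole_map n (- c * d) (n * (c * d) - c * b)"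
  proof -
    have "c * a = n" using cc by (simp add: a mult.left_commute)
    then show ?thesis using cc by (simp add: pole_map_def)
  qed
  finally have "\<alpha> = pole_map n (- c * d) (n * (c * d) - c * b)" .
  moreover have "n * (c * d) - c * b = a * d - b * c" by (simp add: a mult.assoc mult.commute[of b])
  then have "n * (c * d) - c * b \<in> {-1, 1}" using det by (simp only: insert_commute)
  ultimately show ?thesis by blast
qed

section \<open>Transitivity by the Euclidean algorithm\<close>

abbreviation sigma_group :: "(int \<Rightarrow> int) \<Rightarrow> (int \<Rightarrow> int) \<Rightarrow> (ext_rat \<Rightarrow> ext_rat) set" where
  "sigma_group \<iota> \<delta> \<equiv> generate ext_modular_group (range (neumann_sigma \<iota> \<delta>))"

lemma sigma_in_group: "neumann_sigma \<iota> \<delta> n \<in> sigma_group \<iota> \<delta>"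
  by (rule generate.incl) simp

lemma generated_transitive_Fin:
  assumes sign: "range \<delta> \<subseteq> {-1, 1}" and "q > 0"
  shows "\<exists>\<alpha> \<in> sigma_group \<iota> \<delta>. \<alpha> Infty = Fin (of_int p / of_nat q)"
  using \<open>q > 0\<close>
proof (induction q arbitrary: p rule: less_induct)
  case (less q)
  define n m where "n = p div int q" and "m = nat (p mod int q)"
  have p: "p = n * int q + int m" using less.prems by (simp add: n_def m_def)
  have z: "(of_int p / of_nat q :: rat) = of_int n + of_nat m / of_nat q"
    unfolding p using less.prems by (simp add: field_simps)
  show ?case
  proof (cases "m = 0")
    case True
    then have "neumann_sigma \<iota> \<delta> n Infty = Fin (of_int p / of_nat q)"
      unfolding z by (simp add: neumann_sigma_eq)
    then show ?thesis using sigma_in_group by blast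
  next
    case False
    have "m < q"
      using pos_mod_bound[of "int q" p] less.prems by (simp add: m_def nat_less_iff)
    (* This numerator makes the fraction below the preimage of p/q under sigma_n. *)
    define p' where "p' = \<iota> n * int m - \<delta> n * int q"
    obtain \<beta> where \<beta>: "\<beta> \<in> sigma_group \<iota> \<delta>" "\<beta> Infty = Fin (of_int p' / of_nat m)"
      using less.IH[OF \<open>m < q\<close>, of p'] False by blast
    have d: "\<delta> n \<in> {-1, 1}" using sign by auto
    have p'_div: "(of_int p' / of_nat m :: rat) = of_int (\<iota> n) - of_int (\<delta> n) * of_nat q / of_nat m"
      using False by (simp add: p'_def field_simps)
    have "(neumann_sigma \<iota> \<delta> n \<circ> \<beta>) Infty = Fin (of_int p / of_nat q)"
      unfolding z comp_apply \<beta>(2) neumann_sigma_eq p'_div pole_map_Fin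
      using d less.prems False by (auto simp: field_simps)
    moreover have "neumann_sigma \<iota> \<delta> n \<circ> \<beta> \<in> sigma_group \<iota> \<delta>"
      using generate.eng[OF sigma_in_group \<beta>(1)] by simp
    ultimately show ?thesis by blast
  qed
qed

lemma generated_transitive:
  assumes "range \<delta> \<subseteq> {-1, 1}"
  shows "\<exists>\<alpha> \<in> sigma_group \<iota> \<delta>. \<alpha> Infty = r"
proof (cases r)
  case Infty
  have "id \<in> sigma_group \<iota> \<delta>" using generate.one[of ext_modular_group] by simp
  then show ?thesis using Infty by (intro bexI[of _ id]) auto
next
  case (Fin z)
  obtain p q where "quotient_of z = (p, q)" by fastforce
  then have z: "z = of_int p / of_int q" and q: "q > 0"
    by (rule quotient_of_div, rule quotient_of_denom_pos)
  then have "z = of_int p / of_nat (nat q)" by simp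
  then show ?thesis
    using generated_transitive_Fin[OF assms, of "nat q" \<iota> p] q Fin by simp
qed

section \<open>From a Neumann subgroup to its involution\<close>

lemma Neumann_subgroup_imp_involution:
  assumes N: "Neumann_subgroup S"
  shows "\<exists>\<iota> \<delta>. \<iota> \<circ> \<iota> = id \<and> range \<delta> \<subseteq> {-1, 1} \<and>
       (\<forall>n. \<iota> (\<iota> n - \<delta> n) = \<iota> (n + 1) + \<delta> (n + 1) \<and> \<delta> n = \<delta> (\<iota> n)) \<and>
       S = sigma_group \<iota> \<delta>"
proof -
  have sub: "subgroup S ext_modular_group"
    and ex: "\<exists>\<alpha>. \<alpha> \<in> S \<and> \<alpha> Infty = r"
    and uniq: "\<alpha> \<in> S \<Longrightarrow> \<beta> \<in> S \<Longrightarrow> \<alpha> Infty = \<beta> Infty \<Longrightarrow> \<alpha> = \<beta>" for r \<alpha> \<beta>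
    using N unfolding Neumann_subgroup_def by blast+
  interpret S: subgroup S ext_modular_group by (rule sub)
  have "\<exists>i d. d \<in> {-1, 1} \<and> pole_map n i d \<in> S" for n
  proof -
    obtain \<alpha> where \<alpha>: "\<alpha> \<in> S" "\<alpha> Infty = Fin (of_int n)" using ex by blast
    obtain i d where "d \<in> {-1, 1}" "\<alpha> = pole_map n i d"
      using carrier_integer_value[OF S.mem_carrier[OF \<alpha>(1)] \<alpha>(2)] by blast
    then show ?thesis using \<alpha>(1) by blast
  qed
  then obtain \<iota> \<delta> where sign: "\<delta> n \<in> {-1, 1}" and mem: "pole_map n (\<iota> n) (\<delta> n) \<in> S" for n
    by metis
  have param: "i = \<iota> n \<and> d = \<delta> n" if "pole_map n i d \<in> S" for n i d
    using uniq[OF that mem[of n]] by (simp add: pole_map_eq_iff)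
  have inverse: "\<iota> (\<iota> n) = n \<and> \<delta> (\<iota> n) = \<delta> n" for n
    using param[of "\<iota> n" n "\<delta> n"] S.m_inv_closed[OF mem[of n]] pole_map_inv[OF sign] by simp
  have relation: "\<iota> (\<iota> n - \<delta> n) = \<iota> (n + 1) + \<delta> (n + 1)" for n
    using param[of "n + 1"] S.m_closed[OF mem[of n] mem[of "\<iota> n - \<delta> n"]]
      pole_map_comp_neighbour[OF sign sign] by force
  have "sigma_group \<iota> \<delta> \<subseteq> S"
    by (rule group.generate_subgroup_incl[OF group_ext_modular_group _ sub])
      (auto simp: neumann_sigma_eq mem)
  (* Transitivity already holds for the smaller group, so uniqueness in S identifies both. *)
  moreover have "S \<subseteq> sigma_group \<iota> \<delta>"
  proof
    fix \<alpha> assume "\<alpha> \<in> S"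
    obtain \<beta> where "\<beta> \<in> sigma_group \<iota> \<delta>" "\<beta> Infty = \<alpha> Infty"
      using generated_transitive[of \<delta> \<iota> "\<alpha> Infty"] sign by blast
    then show "\<alpha> \<in> sigma_group \<iota> \<delta>"
      using uniq[OF \<open>\<alpha> \<in> S\<close>, of \<beta>] \<open>sigma_group \<iota> \<delta> \<subseteq> S\<close> by auto
  qed
  ultimately show ?thesis
    using inverse relation sign by (intro exI[of _ \<iota>] exI[of _ \<delta>]) (auto simp: fun_eq_iff)
qed

section \<open>From an involution to a Neumann subgroup\<close>

locale neumann_involution =
  fixes \<iota> \<delta> :: "int \<Rightarrow> int"
  assumes iota_iota [simp]: "\<iota> (\<iota> n) = n"
    and delta_sign: "\<delta> n \<in> {-1, 1}"
    and iota_neighbour: "\<iota> (\<iota> n - \<delta> n) = \<iota> (n + 1) + \<delta> (n + 1)"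
    and delta_iota [simp]: "\<delta> (\<iota> n) = \<delta> n"
begin

abbreviation \<sigma> :: "int \<Rightarrow> ext_rat \<Rightarrow> ext_rat" where
  "\<sigma> \<equiv> neumann_sigma \<iota> \<delta>"

text \<open>
  Put \<open>k = \<iota>(n) - \<delta>\<^sub>n\<close>. The neighbour relation at \<open>n\<close> reads
  \<open>\<iota>(k) = \<iota>(n + 1) + \<delta>\<^bsub>n+1\<^esub>\<close>. A second instance expresses \<open>\<iota>(k)\<close> by \<open>\<iota>(n + 1)\<close> and
  \<open>\<delta>\<^sub>k\<close>: the instance at \<open>k\<close> if \<open>\<delta>\<^sub>n = 1\<close>, where \<open>k + 1 = \<iota>(n)\<close>, and the instance at
  \<open>\<iota>(n)\<close> if \<open>\<delta>\<^sub>n = -1\<close>, where \<open>\<iota>(n) + 1 = k\<close>.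
\<close>
lemma delta_Suc: "\<delta> (n + 1) = \<delta> n * \<delta> (\<iota> n - \<delta> n)"
proof (cases "\<delta> n = 1")
  case True
  let ?k = "\<iota> n - 1"
  have "\<iota> (\<iota> ?k - \<delta> ?k) = n + 1" using iota_neighbour[of ?k] True by simp
  then have "\<iota> ?k - \<delta> ?k = \<iota> (n + 1)" using iota_iota by metis
  then show ?thesis using iota_neighbour[of n] True by simp
next
  case False
  then have "\<delta> n = -1" using delta_sign[of n] by simp
  then show ?thesis using iota_neighbour[of n] iota_neighbour[of "\<iota> n"] by simp
qed

lemma sigma_cancel: "\<sigma> n \<circ> \<sigma> (\<iota> n) = id"
  using pole_map_comp_inverse[OF delta_sign] by (simp add: neumann_sigma_eq)

lemma sigma_merge_up: "\<sigma> n \<circ> \<sigma> (\<iota> n - \<delta> n) = \<sigma> (n + 1)"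
  unfolding neumann_sigma_eq pole_map_comp_neighbour[OF delta_sign delta_sign]
  by (simp add: iota_neighbour flip: delta_Suc)

text \<open>
  This is the previous identity at \<open>n - 1\<close>, solved for \<open>\<sigma>\<^bsub>n-1\<^esub>\<close>.
\<close>
lemma sigma_merge_down: "\<sigma> n \<circ> \<sigma> (\<iota> n + \<delta> n) = \<sigma> (n - 1)"
proof -
  let ?k = "\<iota> (n - 1) - \<delta> (n - 1)"
  have k: "\<iota> ?k = \<iota> n + \<delta> n" using iota_neighbour[of "n - 1"] by simp
  have "\<sigma> n \<circ> \<sigma> (\<iota> ?k) = \<sigma> (n - 1) \<circ> (\<sigma> ?k \<circ> \<sigma> (\<iota> ?k))"
    using sigma_merge_up[of "n - 1"] by (simp flip: comp_assoc)
  then show ?thesis using sigma_cancel[of ?k] by (simp add: k)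
qed

lemma sigma_merge:
  assumes "\<bar>k - \<iota> n\<bar> = 1"
  shows "\<exists>n'. \<sigma> n \<circ> \<sigma> k = \<sigma> n'"
proof -
  have "k = \<iota> n - \<delta> n \<or> k = \<iota> n + \<delta> n" using assms delta_sign[of n] by auto
  then show ?thesis using sigma_merge_up sigma_merge_down by blast
qed

definition word :: "int list \<Rightarrow> ext_rat \<Rightarrow> ext_rat" where
  "word ns = foldr (\<lambda>n \<alpha>. \<sigma> n \<circ> \<alpha>) ns id"

lemma word_simps [simp]:
  "word [] = id"
  "word (n # ns) = \<sigma> n \<circ> word ns"
  by (simp_all add: word_def)

definition reduced :: "int list \<Rightarrow> bool" where
  "reduced = successively (\<lambda>n k. \<bar>k - \<iota> n\<bar> \<ge> 2)"

text \<open>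
  A forbidden first pair is cancelled, which leaves a reduced word, or merged into one letter, and
  then the same problem arises for a shorter word.
\<close>
lemma reduced_prepend:
  "reduced ns \<Longrightarrow> \<exists>ms. reduced ms \<and> word ms = \<sigma> n \<circ> word ns"
proof (induction ns arbitrary: n)
  case Nil
  have "reduced [n]" by (simp add: reduced_def)
  then show ?case by (metis word_simps)
next
  case (Cons k ns)
  have ns: "reduced ns" using Cons.prems by (auto simp: reduced_def successively_Cons)
  consider "k = \<iota> n" | "\<bar>k - \<iota> n\<bar> = 1" | "\<bar>k - \<iota> n\<bar> \<ge> 2" by linarith
  then show ?case
  proof cases
    case 1
    have "\<sigma> n \<circ> word (k # ns) = (\<sigma> n \<circ> \<sigma> (\<iota> n)) \<circ> word ns" by (simp add: 1 comp_assoc)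
    then have "\<sigma> n \<circ> word (k # ns) = word ns" by (simp only: sigma_cancel id_comp)
    then show ?thesis using ns by metis
  next
    case 2
    then obtain n' where "\<sigma> n \<circ> \<sigma> k = \<sigma> n'" using sigma_merge by blast
    then have "\<sigma> n \<circ> word (k # ns) = \<sigma> n' \<circ> word ns" by (simp flip: comp_assoc)
    then show ?thesis using Cons.IH[OF ns, of n'] by (simp only:)
  next
    case 3
    then have "reduced (n # k # ns)" using Cons.prems by (simp add: reduced_def)
    then show ?thesis by (metis word_simps(2))
  qed
qed

lemma reduced_comp:
  "reduced ns \<Longrightarrow> \<exists>ls. reduced ls \<and> word ls = word ms \<circ> word ns"
proof (induction ms)
  case Nil
  then show ?case by auto
next
  case (Cons m ms)
  then obtain ls where "reduced ls" "word ls = word ms \<circ> word ns" by blast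
  then show ?case using reduced_prepend[of ls m] by (simp only: word_simps comp_assoc)
qed

lemma generated_reduced:
  assumes "\<alpha> \<in> sigma_group \<iota> \<delta>"
  shows "\<exists>ns. reduced ns \<and> \<alpha> = word ns"
  using assms
proof (induction \<alpha> rule: generate.induct)
  case one
  show ?case by (rule exI[of _ "[]"]) (simp add: reduced_def)
next
  case (incl h)
  then obtain n where "h = \<sigma> n" by blast
  then show ?case by (intro exI[of _ "[n]"]) (simp add: reduced_def)
next
  case (inv h)
  then obtain n where "h = \<sigma> n" by blast
  then have "inv\<^bsub>ext_modular_group\<^esub> h = \<sigma> (\<iota> n)"
    using pole_map_inv[OF delta_sign] by (simp add: neumann_sigma_eq)
  then show ?case by (intro exI[of _ "[\<iota> n]"]) (simp add: reduced_def)
next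
  case (eng g h)
  then obtain ms ns where "g = word ms" "reduced ns" "h = word ns" by blast
  then show ?case using reduced_comp[of ns ms] by (auto intro: sym)
qed

text \<open>
  Ping-pong: a point at distance less than 1 from the next letter \<open>k\<close> has distance greater than 1
  from the pole \<open>\<iota>(n)\<close>, because \<open>\<bar>k - \<iota>(n)\<bar> \<ge> 2\<close>; hence \<open>\<sigma>\<^sub>n\<close> moves it to a point at distance
  less than 1 from \<open>n\<close>.
\<close>
lemma reduced_word_Infty:
  "reduced (n # ns) \<Longrightarrow> \<exists>x. word (n # ns) Infty = Fin x \<and> \<bar>x - of_int n\<bar> < 1"
proof (induction ns arbitrary: n)
  case Nil
  then show ?case by (simp add: neumann_sigma_eq)
next
  case (Cons k ns)
  from Cons.prems have red: "reduced (k # ns)" and far: "\<bar>k - \<iota> n\<bar> \<ge> 2"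
    by (simp_all add: reduced_def)
  obtain x where x: "word (k # ns) Infty = Fin x" "\<bar>x - of_int k\<bar> < 1"
    using Cons.IH[OF red] by blast
  have "(of_int \<bar>k - \<iota> n\<bar> :: rat) \<ge> of_int 2" using far by (simp only: of_int_le_iff)
  then have "\<bar>of_int k - of_int (\<iota> n) :: rat\<bar> \<ge> 2" by simp
  then have gt: "\<bar>x - of_int (\<iota> n)\<bar> > 1" using x(2) by linarith
  then have ne: "x \<noteq> of_int (\<iota> n)" by auto
  have "\<bar>of_int (\<delta> n) :: rat\<bar> = 1" using delta_sign[of n] by auto
  then have "\<bar>of_int (\<delta> n) / (x - of_int (\<iota> n))\<bar> < 1" using gt by (simp add: abs_divide)
  moreover have "word (n # k # ns) Infty =
      Fin (of_int n - of_int (\<delta> n) / (x - of_int (\<iota> n)))"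
    using x(1) ne by (simp add: neumann_sigma_eq[of _ _ n] pole_map_Fin)
  ultimately show ?case by simp
qed

lemma generated_stabilizer_trivial:
  assumes "\<alpha> \<in> sigma_group \<iota> \<delta>" and "\<alpha> Infty = Infty"
  shows "\<alpha> = id"
proof -
  obtain ns where ns: "reduced ns" "\<alpha> = word ns" using generated_reduced[OF assms(1)] by blast
  show ?thesis
  proof (cases ns)
    case Nil
    then show ?thesis using ns by simp
  next
    case (Cons m ms)
    then show ?thesis using reduced_word_Infty[of m ms] ns assms(2) by auto
  qed
qed

lemma Neumann_subgroup_generated: "Neumann_subgroup (sigma_group \<iota> \<delta>)"
proof -
  let ?M = ext_modular_group
  interpret M: group ?M by (rule group_ext_modular_group)
  have "range \<sigma> \<subseteq> carrier ?M"
    using neumann_sigma_in_carrier[of \<delta> _ \<iota>] delta_sign by blast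
  then have sub: "subgroup (sigma_group \<iota> \<delta>) ?M" by (rule M.generate_is_subgroup)
  have "\<alpha> = \<beta>" if \<alpha>: "\<alpha> \<in> sigma_group \<iota> \<delta>" and \<beta>: "\<beta> \<in> sigma_group \<iota> \<delta>"
    and eq: "\<alpha> Infty = \<beta> Infty" for \<alpha> \<beta>
  proof -
    have carr: "\<alpha> \<in> carrier ?M" "\<beta> \<in> carrier ?M"
      using subgroup.mem_carrier[OF sub] \<alpha> \<beta> by blast+
    have inv: "inv\<^bsub>?M\<^esub> \<beta> \<circ> \<beta> = id" using M.l_inv[OF carr(2)] by simp
    have "inv\<^bsub>?M\<^esub> \<beta> \<circ> \<alpha> \<in> sigma_group \<iota> \<delta>"
      using subgroup.m_closed[OF sub subgroup.m_inv_closed[OF sub \<beta>] \<alpha>] by simp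
    moreover have "(inv\<^bsub>?M\<^esub> \<beta> \<circ> \<alpha>) Infty = Infty"
      using fun_cong[OF inv, of Infty] eq by simp
    ultimately have "inv\<^bsub>?M\<^esub> \<beta> \<circ> \<alpha> = inv\<^bsub>?M\<^esub> \<beta> \<circ> \<beta>"
      using generated_stabilizer_trivial inv by simp
    then show ?thesis
      using M.l_cancel[of "inv\<^bsub>?M\<^esub> \<beta>" \<alpha> \<beta>] carr by simp
  qed
  moreover have "\<exists>\<alpha> \<in> sigma_group \<iota> \<delta>. \<alpha> Infty = r" for r
    by (rule generated_transitive) (use delta_sign in blast)
  ultimately show ?thesis unfolding Neumann_subgroup_def using sub by metis
qed

end

section \<open>The characterization\<close>

theorem theorem2p3:
  fixes S :: "(ext_rat \<Rightarrow> ext_rat) set"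
  assumes "subgroup S ext_modular_group"
  shows "Neumann_subgroup S \<longleftrightarrow>
    (\<exists>(\<iota> :: int \<Rightarrow> int) (\<delta> :: int \<Rightarrow> int).
       \<iota> \<circ> \<iota> = id \<and> range \<delta> \<subseteq> {-1, 1} \<and>
       (\<forall>n. \<iota> (\<iota> n - \<delta> n) = \<iota> (n + 1) + \<delta> (n + 1) \<and> \<delta> n = \<delta> (\<iota> n)) \<and>
       S = generate ext_modular_group (range (neumann_sigma \<iota> \<delta>)))"
proof
  assume "Neumann_subgroup S"
  then show "\<exists>\<iota> \<delta>. \<iota> \<circ> \<iota> = id \<and> range \<delta> \<subseteq> {-1, 1} \<and>
       (\<forall>n. \<iota> (\<iota> n - \<delta> n) = \<iota> (n + 1) + \<delta> (n + 1) \<and> \<delta> n = \<delta> (\<iota> n)) \<and>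
       S = generate ext_modular_group (range (neumann_sigma \<iota> \<delta>))"
    by (rule Neumann_subgroup_imp_involution)
next
  assume "\<exists>\<iota> \<delta>. \<iota> \<circ> \<iota> = id \<and> range \<delta> \<subseteq> {-1, 1} \<and>
       (\<forall>n. \<iota> (\<iota> n - \<delta> n) = \<iota> (n + 1) + \<delta> (n + 1) \<and> \<delta> n = \<delta> (\<iota> n)) \<and>
       S = generate ext_modular_group (range (neumann_sigma \<iota> \<delta>))"
  then obtain \<iota> \<delta> :: "int \<Rightarrow> int" where invol: "\<iota> \<circ> \<iota> = id" and sign: "range \<delta> \<subseteq> {-1, 1}"
    and rel: "\<And>n. \<iota> (\<iota> n - \<delta> n) = \<iota> (n + 1) + \<delta> (n + 1)" and inv: "\<And>n. \<delta> n = \<delta> (\<iota> n)"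
    and S: "S = sigma_group \<iota> \<delta>"
    by blast
  interpret neumann_involution \<iota> \<delta>
    by unfold_locales
      (use fun_cong[OF invol] sign rel inv in \<open>auto simp: image_subset_iff\<close>)
  show "Neumann_subgroup S" unfolding S by (rule Neumann_subgroup_generated)
qed

end
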